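(* Every regularly co-generating set in $\mathsf{MS}$ has either infinitely many objects or an object whose underlying set is infinite.
   Context: Supernatural numbers: let $\mathbb{P}$ be the set of primes and $\mathbb{N}=\{0,1,2,\dots\}$. A supernatural number is a function $\nu\colon\mathbb{P}\to\mathbb{N}\cup\{\infty\}$; $\mathcal{N}$ is the set of supernatural numbers, a complete lattice under the pointwise order. For $n\in\{1,2,3,\dots\}$, $\nu_n\in\mathcal{N}$ sends $p$ to the exponent of $p$ in the prime factorisation of $n$. $\mathcal{N}$ carries the topology with open basis $U_n=\{\nu\in\mathcal{N}\mid\nu\ge\nu_n\}$, $n\ge 1$. Multisets: a Boolean space is a compact Hausdorff space with a basis of clopen sets. The category $\mathsf{MS}$ of multisets has as objects the pairs $(X,\zeta_X)$ with $X$ a Boolean space and $\zeta_X\colon X\to\mathcal{N}$ continuous; an arrow $f\colon(X,\zeta_X)\to(Y,\zeta_Y)$ is a continuous function $f\colon X\to Y$ such that $\zeta_X(x)\ge\zeta_Y(f(x))$ for every $x\in X$. The category $\mathsf{MS}$ is complete and cocomplete. A set of objects $\mathcal{G}$ in $\mathsf{MS}$ is regularly co-generating if, for every multiset $X$, the canonical arrow $X\to\prod_{G\in\mathcal{G},\,t\in\hom(X,G)}G$, whose $(G,t)$-component is $t$, is regular monic (i.e. an equaliser of some pair of parallel arrows in $\mathsf{MS}$). *)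

theory Defs
  imports "HOL-Analysis.Analysis" "HOL-Computational_Algebra.Primes"
    "HOL-Library.Extended_Nat"
begin

section \<open>Supernatural numbers\<close>

typedef prime_nat = "{p :: nat. prime p}"
  morphisms nat_of_prime Abs_prime_nat
  using two_is_prime_nat by blast

text \<open>
  The order on supernatural numbers is the pointwise order which the function type
  inherits from \<^typ>\<open>enat\<close>; it makes them a complete lattice.
\<close>

type_synonym supernat = "prime_nat \<Rightarrow> enat"

definition supernat_of :: "nat \<Rightarrow> supernat"
  where "supernat_of n = (\<lambda>p. enat (multiplicity (nat_of_prime p) n))"

definition supernat_up :: "nat \<Rightarrow> supernat set"
  where "supernat_up n = {\<nu>. supernat_of n \<le> \<nu>}"

text \<open>
  This is not the product topology which the type class instances put on the function
  type, so it is introduced as an explicit topology object. The generating sets are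
  closed under binary intersection, hence a basis (lemma \<open>openin_supernat_topology\<close>).
\<close>

definition supernat_topology :: "supernat topology"
  where "supernat_topology = topology_generated_by {supernat_up n |n. 1 \<le> n}"

lemma prime_nat_of_prime [simp]: "prime (nat_of_prime p)"
  using nat_of_prime by auto

lemma supernat_up_iff: "\<nu> \<in> supernat_up n \<longleftrightarrow> (\<forall>p. enat (multiplicity (nat_of_prime p) n) \<le> \<nu> p)"
  by (simp add: supernat_up_def supernat_of_def le_fun_def)

lemma supernat_up_1 [simp]: "supernat_up (Suc 0) = UNIV"
  by (auto simp: supernat_up_iff enat_0)

lemma supernat_up_Int:
  assumes "1 \<le> m" "1 \<le> n"
  shows "supernat_up m \<inter> supernat_up n = supernat_up (lcm m n)"
proof -
  have "multiplicity (nat_of_prime p) (lcm m n)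
      = max (multiplicity (nat_of_prime p) m) (multiplicity (nat_of_prime p) n)" for p
    using assms by (intro multiplicity_lcm) auto
  moreover have "enat (max a b) \<le> x \<longleftrightarrow> enat a \<le> x \<and> enat b \<le> x" for a b x
    by (cases x) auto
  ultimately show ?thesis
    by (auto simp: supernat_up_iff)
qed

lemma topspace_supernat_topology [simp]: "topspace supernat_topology = UNIV"
  unfolding supernat_topology_def topology_generated_by_topspace
  using supernat_up_1 by (metis (mono_tags, lifting) Sup_upper One_nat_def le_refl mem_Collect_eq top.extremum_uniqueI)

lemma openin_supernat_topology:
  "openin supernat_topology = arbitrary union_of (\<lambda>S. \<exists>n\<ge>1. S = supernat_up n)"
  unfolding openin_topology_base_unique
proof (intro conjI allI impI)
  fix V assume "\<exists>n\<ge>1. V = supernat_up n"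
  then show "openin supernat_topology V"
    unfolding supernat_topology_def by (intro topology_generated_by_Basis) auto
next
  fix U x assume *: "openin supernat_topology U \<and> x \<in> U"
  then have "generate_topology_on {supernat_up n |n. 1 \<le> n} U"
    unfolding supernat_topology_def by (simp add: openin_topology_generated_by)
  then have "\<forall>x\<in>U. \<exists>n\<ge>1. x \<in> supernat_up n \<and> supernat_up n \<subseteq> U"
  proof induction
    case (Int a b)
    show ?case
    proof
      fix x assume "x \<in> a \<inter> b"
      then obtain m n where "m \<ge> 1" "x \<in> supernat_up m" "supernat_up m \<subseteq> a"
          "n \<ge> 1" "x \<in> supernat_up n" "supernat_up n \<subseteq> b"
        using Int.IH by blast
      then show "\<exists>n\<ge>1. x \<in> supernat_up n \<and> supernat_up n \<subseteq> a \<inter> b"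
        using supernat_up_Int[of m n]
        by (intro exI[of _ "lcm m n"]) (auto simp: Suc_le_eq lcm_pos_nat)
    qed
  next
    case (UN K)
    then show ?case by (meson Sup_upper UnionE dual_order.trans)
  qed auto
  then show "\<exists>V. (\<exists>n\<ge>1. V = supernat_up n) \<and> x \<in> V \<and> V \<subseteq> U"
    using * by blast
qed

section \<open>The category of multisets\<close>

definition boolean_space :: "'a topology \<Rightarrow> bool"
  where "boolean_space T \<longleftrightarrow> compact_space T \<and> Hausdorff_space T \<and>
    (\<exists>B. (\<forall>C\<in>B. openin T C \<and> closedin T C) \<and> openin T = arbitrary union_of (\<lambda>C. C \<in> B))"

type_synonym 'a mset_obj = "'a topology \<times> ('a \<Rightarrow> supernat)"

abbreviation carrier :: "'a mset_obj \<Rightarrow> 'a set"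
  where "carrier X \<equiv> topspace (fst X)"

abbreviation mult :: "'a mset_obj \<Rightarrow> 'a \<Rightarrow> supernat"
  where "mult X \<equiv> snd X"

text \<open>
  Multiplicity functions and arrows are required to be extensional (\<^const>\<open>undefined\<close>
  outside the carrier), so that HOL equality of objects and of arrows is the intended one.
  Otherwise one multiset would be represented by many distinct pairs, and one arrow would
  occur many times in a hom-set.
\<close>

definition MS :: "'a mset_obj set"
  where "MS = {X. boolean_space (fst X) \<and> mult X \<in> extensional (carrier X) \<and>
    continuous_map (fst X) supernat_topology (mult X)}"

definition ms_hom :: "'a mset_obj \<Rightarrow> 'b mset_obj \<Rightarrow> ('a \<Rightarrow> 'b) set"
  where "ms_hom X Y = {f \<in> extensional (carrier X). continuous_map (fst X) (fst Y) f \<and>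
    (\<forall>x\<in>carrier X. mult X x \<ge> mult Y (f x))}"

abbreviation ms_comp :: "'a mset_obj \<Rightarrow> ('b \<Rightarrow> 'c) \<Rightarrow> ('a \<Rightarrow> 'b) \<Rightarrow> 'a \<Rightarrow> 'c"
  where "ms_comp X g f \<equiv> compose (carrier X) g f"

section \<open>Products\<close>

text \<open>
  The concrete product: the topological product with the pointwise supremum of the
  multiplicities. Lemmas \<open>ms_prod_in_MS\<close>, \<open>ms_proj_hom\<close> and \<open>ms_prod_universal\<close>
  show that it is the categorical product in \<^const>\<open>MS\<close>; in the last of them the type of
  the points of the test object is arbitrary.
\<close>

definition ms_prod :: "'i set \<Rightarrow> ('i \<Rightarrow> 'a mset_obj) \<Rightarrow> ('i \<Rightarrow> 'a) mset_obj"
  where "ms_prod I F =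
    (product_topology (\<lambda>i. fst (F i)) I,
     \<lambda>x\<in>(\<Pi>\<^sub>E i\<in>I. carrier (F i)). SUP i\<in>I. mult (F i) (x i))"

definition ms_proj :: "'i set \<Rightarrow> ('i \<Rightarrow> 'a mset_obj) \<Rightarrow> 'i \<Rightarrow> ('i \<Rightarrow> 'a) \<Rightarrow> 'a"
  where "ms_proj I F i = (\<lambda>x\<in>carrier (ms_prod I F). x i)"

definition ms_tuple :: "'z mset_obj \<Rightarrow> 'i set \<Rightarrow> ('i \<Rightarrow> 'z \<Rightarrow> 'a) \<Rightarrow> 'z \<Rightarrow> ('i \<Rightarrow> 'a)"
  where "ms_tuple Z I f = (\<lambda>z\<in>carrier Z. \<lambda>i\<in>I. f i z)"

lemma carrier_ms_prod [simp]: "carrier (ms_prod I F) = (\<Pi>\<^sub>E i\<in>I. carrier (F i))"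
  by (simp add: ms_prod_def)

lemma fst_ms_prod: "fst (ms_prod I F) = product_topology (\<lambda>i. fst (F i)) I"
  by (simp add: ms_prod_def)

lemma mult_ms_prod:
  "x \<in> (\<Pi>\<^sub>E i\<in>I. carrier (F i)) \<Longrightarrow> mult (ms_prod I F) x = (SUP i\<in>I. mult (F i) (x i))"
  by (simp add: ms_prod_def)

lemma boolean_space_alt:
  "boolean_space T \<longleftrightarrow> compact_space T \<and> Hausdorff_space T \<and>
    (\<forall>U x. openin T U \<and> x \<in> U \<longrightarrow> (\<exists>C. openin T C \<and> closedin T C \<and> x \<in> C \<and> C \<subseteq> U))"
proof -
  have "(\<exists>B. (\<forall>C\<in>B. openin T C \<and> closedin T C) \<and> openin T = arbitrary union_of (\<lambda>C. C \<in> B))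
    \<longleftrightarrow> (\<forall>U x. openin T U \<and> x \<in> U \<longrightarrow> (\<exists>C. openin T C \<and> closedin T C \<and> x \<in> C \<and> C \<subseteq> U))"
    (is "?L \<longleftrightarrow> ?R")
  proof
    assume ?L then show ?R unfolding openin_topology_base_unique by meson
  next
    assume ?R then show ?L
      by (intro exI[of _ "{C. openin T C \<and> closedin T C}"])
        (auto simp: openin_topology_base_unique)
  qed
  then show ?thesis by (simp add: boolean_space_def)
qed

lemma boolean_space_product_topology:
  assumes "\<And>i. i \<in> I \<Longrightarrow> boolean_space (T i)"
  shows "boolean_space (product_topology T I)"
  unfolding boolean_space_alt
proof (intro conjI allI impI)
  show "compact_space (product_topology T I)"
    using assms by (auto simp: compact_space_product_topology boolean_space_alt)
  show "Hausdorff_space (product_topology T I)"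
    using assms by (auto simp: Hausdorff_space_product_topology boolean_space_alt)
next
  fix U x assume "openin (product_topology T I) U \<and> x \<in> U"
  then obtain V where V: "finite {i \<in> I. V i \<noteq> topspace (T i)}"
      "\<And>i. i \<in> I \<Longrightarrow> openin (T i) (V i)" "x \<in> Pi\<^sub>E I V" "Pi\<^sub>E I V \<subseteq> U"
    unfolding openin_product_topology_alt by meson
  have "\<exists>C. openin (T i) C \<and> closedin (T i) C \<and> x i \<in> C \<and> C \<subseteq> V i \<and>
      (V i = topspace (T i) \<longrightarrow> C = topspace (T i))" if i: "i \<in> I" for i
  proof (cases "V i = topspace (T i)")
    case True
    then show ?thesis using V(3) i by (intro exI[of _ "topspace (T i)"]) auto
  next
    case False
    have "x i \<in> V i" using V(3) i by auto
    then show ?thesis using False assms[OF i] V(2)[OF i] unfolding boolean_space_alt by blast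
  qed
  then obtain C where C: "\<And>i. i \<in> I \<Longrightarrow> openin (T i) (C i) \<and> closedin (T i) (C i) \<and>
      x i \<in> C i \<and> C i \<subseteq> V i \<and> (V i = topspace (T i) \<longrightarrow> C i = topspace (T i))"
    by metis
  have "finite {i \<in> I. C i \<noteq> topspace (T i)}"
    by (rule finite_subset[OF _ V(1)]) (use C in auto)
  then have "openin (product_topology T I) (Pi\<^sub>E I C)"
    using C by (simp add: openin_PiE_gen)
  moreover have "closedin (product_topology T I) (Pi\<^sub>E I C)"
    using C by (simp add: closedin_product_topology)
  moreover have "x \<in> Pi\<^sub>E I C" using C V(3) by (auto simp: PiE_iff)
  moreover have "Pi\<^sub>E I C \<subseteq> U"
    using C V(4) PiE_mono[of I C V] by blast
  ultimately show "\<exists>C. openin (product_topology T I) C \<and> closedin (product_topology T I) C \<and>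
      x \<in> C \<and> C \<subseteq> U"
    by blast
qed

lemma continuous_map_supernat:
  "continuous_map T supernat_topology f \<longleftrightarrow>
    (\<forall>n\<ge>1. openin T {x \<in> topspace T. f x \<in> supernat_up n})"
proof -
  have "f ` topspace T \<subseteq> \<Union> {supernat_up n |n. 1 \<le> n}"
    using topspace_supernat_topology unfolding supernat_topology_def by simp
  moreover have "f -` S \<inter> topspace T = {x \<in> topspace T. f x \<in> S}" for S
    by auto
  ultimately show ?thesis
    unfolding supernat_topology_def continuous_on_generated_topo_iff by auto
qed

lemma supernat_up_prime_power:
  "supernat_up (nat_of_prime p ^ k) = {\<nu>. enat k \<le> \<nu> p}"
proof -
  have "multiplicity (nat_of_prime q) (nat_of_prime p ^ k) = (if q = p then k else 0)" for q
  proof (cases "q = p")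
    case False
    then have "nat_of_prime q \<noteq> nat_of_prime p" by (simp add: nat_of_prime_inject)
    then show ?thesis using False by (simp add: multiplicity_distinct_prime_power)
  qed (simp add: prime_gt_Suc_0_nat)
  then have "\<nu> \<in> supernat_up (nat_of_prime p ^ k) \<longleftrightarrow> (\<forall>q. enat (if q = p then k else 0) \<le> \<nu> q)" for \<nu>
    by (simp only: supernat_up_iff)
  moreover have "(\<forall>q. enat (if q = p then k else 0) \<le> \<nu> q) \<longleftrightarrow> enat k \<le> \<nu> p" for \<nu> :: supernat
    by (auto simp: enat_0 split: if_splits)
  ultimately show ?thesis by blast
qed

lemma continuous_map_supernat_SUP:
  assumes "\<And>i. i \<in> I \<Longrightarrow> continuous_map T supernat_topology (f i)"
  shows "continuous_map T supernat_topology (\<lambda>x. SUP i\<in>I. f i x)"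
  unfolding continuous_map_supernat
proof (intro allI impI)
  fix n :: nat assume n: "1 \<le> n"
  define P where "P = {p. nat_of_prime p \<in> prime_factors n}"
  define k where "k p = multiplicity (nat_of_prime p) n" for p
  have "finite P"
    unfolding P_def by (rule finite_vimageI[unfolded vimage_def]) (auto intro: injI simp: nat_of_prime_inject)
  have k: "k p > 0" if "p \<in> P" for p
    using that by (simp add: P_def k_def prime_factors_multiplicity)
  have k0: "k p = 0" if "p \<notin> P" for p
    using that by (simp add: P_def k_def prime_factors_multiplicity)
  have SUP: "enat (k p) \<le> (SUP i\<in>I. f i x) p \<longleftrightarrow> (\<exists>i\<in>I. enat (k p) \<le> f i x p)"
    if p: "p \<in> P" for p x
  proof -
    obtain m where "k p = Suc m" using k p gr0_implies_Suc by blast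
    then show ?thesis by (simp add: Suc_ile_eq less_SUP_iff image_image)
  qed
  have "\<nu> \<in> supernat_up n \<longleftrightarrow> (\<forall>p\<in>P. enat (k p) \<le> \<nu> p)" for \<nu>
    unfolding supernat_up_iff k_def[symmetric] using k0 by (metis enat_0 zero_le)
  then have "(SUP i\<in>I. f i x) \<in> supernat_up n \<longleftrightarrow> (\<forall>p\<in>P. \<exists>i\<in>I. enat (k p) \<le> f i x p)" for x
    using SUP by blast
  then have "{x \<in> topspace T. (SUP i\<in>I. f i x) \<in> supernat_up n} =
      topspace T \<inter> (\<Inter>p\<in>P. \<Union>i\<in>I. {x \<in> topspace T. f i x \<in> supernat_up (nat_of_prime p ^ k p)})"
    unfolding supernat_up_prime_power by blast
  moreover have "openin T (\<Union>i\<in>I. {x \<in> topspace T. f i x \<in> supernat_up (nat_of_prime p ^ k p)})" for p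
    using assms unfolding continuous_map_supernat
    by (intro openin_Union) (auto simp: Suc_le_eq prime_gt_0_nat)
  ultimately show "openin T {x \<in> topspace T. (SUP i\<in>I. f i x) \<in> supernat_up n}"
    using \<open>finite P\<close> by (cases "P = {}") (auto intro!: openin_Int openin_Inter)
qed

lemma ms_prod_in_MS:
  assumes "\<And>i. i \<in> I \<Longrightarrow> F i \<in> MS"
  shows "ms_prod I F \<in> MS"
proof -
  let ?T = "product_topology (\<lambda>i. fst (F i)) I"
  have "continuous_map ?T supernat_topology (\<lambda>x. mult (F i) (x i))" if "i \<in> I" for i
    using continuous_map_compose[OF continuous_map_product_projection[OF that], of "\<lambda>i. fst (F i)"]
      assms[OF that] by (auto simp: MS_def o_def)
  then have "continuous_map ?T supernat_topology (\<lambda>x. SUP i\<in>I. mult (F i) (x i))"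
    by (rule continuous_map_supernat_SUP)
  then have "continuous_map ?T supernat_topology (mult (ms_prod I F))"
    by (rule continuous_map_eq) (simp add: mult_ms_prod)
  moreover have "mult (ms_prod I F) \<in> extensional (carrier (ms_prod I F))"
    by (simp add: ms_prod_def)
  moreover have "boolean_space ?T"
    using assms by (intro boolean_space_product_topology) (auto simp: MS_def)
  ultimately show ?thesis
    by (simp add: MS_def fst_ms_prod)
qed

lemma ms_proj_hom:
  assumes "i \<in> I"
  shows "ms_proj I F i \<in> ms_hom (ms_prod I F) (F i)"
proof -
  have "continuous_map (product_topology (\<lambda>i. fst (F i)) I) (fst (F i)) (ms_proj I F i)"
    by (rule continuous_map_eq[OF continuous_map_product_projection[OF assms]])
      (simp add: ms_proj_def)
  then show ?thesis
    using assms by (auto simp: ms_hom_def ms_proj_def fst_ms_prod mult_ms_prod intro: SUP_upper)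
qed

lemma ms_tuple_hom:
  assumes "\<And>i. i \<in> I \<Longrightarrow> f i \<in> ms_hom Z (F i)"
  shows "ms_tuple Z I f \<in> ms_hom Z (ms_prod I F)"
proof -
  have c: "continuous_map (fst Z) (product_topology (\<lambda>i. fst (F i)) I) (ms_tuple Z I f)"
    unfolding continuous_map_componentwise
  proof (intro conjI ballI)
    fix i assume i: "i \<in> I"
    show "continuous_map (fst Z) (fst (F i)) (\<lambda>x. ms_tuple Z I f x i)"
      by (rule continuous_map_eq[of _ _ "f i"])
        (use assms[OF i] i in \<open>auto simp: ms_hom_def ms_tuple_def\<close>)
  qed (auto simp: ms_tuple_def)
  have "mult (ms_prod I F) (ms_tuple Z I f z) \<le> mult Z z" if z: "z \<in> carrier Z" for z
  proof -
    have "ms_tuple Z I f z \<in> (\<Pi>\<^sub>E i\<in>I. carrier (F i))"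
      using c z by (auto simp: continuous_map_def)
    then show ?thesis
      using assms z by (auto simp: mult_ms_prod ms_tuple_def ms_hom_def intro!: SUP_least)
  qed
  then show ?thesis
    using c by (simp add: ms_hom_def fst_ms_prod ms_tuple_def)
qed

lemma ms_prod_universal:
  fixes Z :: "'z mset_obj"
  assumes "\<And>i. i \<in> I \<Longrightarrow> f i \<in> ms_hom Z (F i)"
  shows "k \<in> ms_hom Z (ms_prod I F) \<and> (\<forall>i\<in>I. ms_comp Z (ms_proj I F i) k = f i)
    \<longleftrightarrow> k = ms_tuple Z I f"
proof
  assume k: "k \<in> ms_hom Z (ms_prod I F) \<and> (\<forall>i\<in>I. ms_comp Z (ms_proj I F i) k = f i)"
  then have m: "k z \<in> (\<Pi>\<^sub>E i\<in>I. carrier (F i))" if "z \<in> carrier Z" for z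
    using that by (auto simp: ms_hom_def continuous_map_def fst_ms_prod)
  show "k = ms_tuple Z I f"
  proof (rule extensionalityI[of _ "carrier Z"])
    fix z assume z: "z \<in> carrier Z"
    have "k z i = f i z" if "i \<in> I" for i
      using k that m[OF z] z by (auto simp: compose_def ms_proj_def fun_eq_iff split: if_splits)
    then show "k z = ms_tuple Z I f z"
      using m[OF z] z by (intro extensionalityI[of _ I]) (auto simp: ms_tuple_def PiE_iff)
  qed (use k in \<open>auto simp: ms_hom_def ms_tuple_def\<close>)
next
  assume k: "k = ms_tuple Z I f"
  have h: "k \<in> ms_hom Z (ms_prod I F)"
    unfolding k using assms by (rule ms_tuple_hom)
  have "ms_comp Z (ms_proj I F i) k = f i" if "i \<in> I" for i
  proof (rule extensionalityI[of _ "carrier Z"])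
    fix z assume z: "z \<in> carrier Z"
    then have "k z \<in> (\<Pi>\<^sub>E i\<in>I. carrier (F i))"
      using h by (auto simp: ms_hom_def continuous_map_def fst_ms_prod)
    then show "ms_comp Z (ms_proj I F i) k z = f i z"
      using that z by (auto simp: compose_def ms_proj_def k ms_tuple_def)
  qed (use assms that in \<open>auto simp: ms_hom_def\<close>)
  with h show "k \<in> ms_hom Z (ms_prod I F) \<and> (\<forall>i\<in>I. ms_comp Z (ms_proj I F i) k = f i)"
    by blast
qed

section \<open>Regular monomorphisms and regularly co-generating sets\<close>

text \<open>
  HOL cannot quantify over types inside a formula, so a quantifier over all multisets is a
  quantifier over the multisets whose points lie in a given type. The type is passed as an
  \<^typ>\<open>'u itself\<close> argument and left as a type variable, which makes it universally quantified
  in any theorem: the type \<^typ>\<open>'u\<close> houses the target of the parallel pair and the test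
  objects of the equaliser, and \<^typ>\<open>'x\<close> houses the multisets that are to be embedded into a
  product.
\<close>

definition ms_equaliser ::
  "'u itself \<Rightarrow> 'a mset_obj \<Rightarrow> 'b mset_obj \<Rightarrow> 'c mset_obj \<Rightarrow>
    ('a \<Rightarrow> 'b) \<Rightarrow> ('b \<Rightarrow> 'c) \<Rightarrow> ('b \<Rightarrow> 'c) \<Rightarrow> bool"
  where "ms_equaliser _ E X Y e u v \<longleftrightarrow>
    e \<in> ms_hom E X \<and> u \<in> ms_hom X Y \<and> v \<in> ms_hom X Y \<and> ms_comp E u e = ms_comp E v e \<and>
    (\<forall>Z\<in>(MS :: 'u mset_obj set). \<forall>h\<in>ms_hom Z X. ms_comp Z u h = ms_comp Z v h \<longrightarrow>
      (\<exists>!k. k \<in> ms_hom Z E \<and> ms_comp Z e k = h))"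

definition ms_regular_monic ::
  "'u itself \<Rightarrow> 'a mset_obj \<Rightarrow> 'b mset_obj \<Rightarrow> ('a \<Rightarrow> 'b) \<Rightarrow> bool"
  where "ms_regular_monic U E X e \<longleftrightarrow>
    (\<exists>Y\<in>(MS :: 'u mset_obj set). \<exists>u v. ms_equaliser U E X Y e u v)"

definition hom_index :: "'g mset_obj set \<Rightarrow> 'x mset_obj \<Rightarrow> ('g mset_obj \<times> ('x \<Rightarrow> 'g)) set"
  where "hom_index \<G> X = (SIGMA G:\<G>. ms_hom X G)"

definition canonical_arrow ::
  "'g mset_obj set \<Rightarrow> 'x mset_obj \<Rightarrow> 'x \<Rightarrow> ('g mset_obj \<times> ('x \<Rightarrow> 'g) \<Rightarrow> 'g)"
  where "canonical_arrow \<G> X = ms_tuple X (hom_index \<G> X) (\<lambda>(G, t). t)"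

definition regularly_cogenerating ::
  "'x itself \<Rightarrow> 'u itself \<Rightarrow> 'g mset_obj set \<Rightarrow> bool"
  where "regularly_cogenerating _ U \<G> \<longleftrightarrow>
    (\<forall>X\<in>(MS :: 'x mset_obj set).
      ms_regular_monic U X (ms_prod (hom_index \<G> X) (\<lambda>(G, t). G)) (canonical_arrow \<G> X))"

end

theory Submission
  imports Defs
begin

text \<open>
  A regular monomorphism preserves multiplicities exactly. Applied to the canonical arrow of a
  one-point multiset of multiplicity \<open>\<nu>\<close>, this writes \<open>\<nu>\<close> as a supremum of multiplicities
  occurring in members of a regularly co-generating set. If that set and all its members are finite,
  only finitely many suprema can arise, whereas there are infinitely many supernatural numbers.
\<close>

text \<open>The restriction makes the multiplicity function extensional, as \<open>MS\<close>
  demands.\<close>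

definition ms_point :: "'a \<Rightarrow> supernat \<Rightarrow> 'a mset_obj"
  where "ms_point a \<nu> = (discrete_topology {a}, \<lambda>x\<in>{a}. \<nu>)"

lemma ms_point_simps [simp]:
  "fst (ms_point a \<nu>) = discrete_topology {a}" "mult (ms_point a \<nu>) a = \<nu>"
  by (simp_all add: ms_point_def)

lemma ms_point_in_MS: "ms_point a \<nu> \<in> MS"
proof -
  have "boolean_space (discrete_topology {a})"
    unfolding boolean_space_alt
    by (auto simp: compact_space_discrete_topology closedin_def)
  then show ?thesis
    by (simp add: MS_def ms_point_def)
qed

lemma ms_point_hom:
  assumes "x \<in> carrier X" "mult X x \<le> \<nu>"
  shows "(\<lambda>z\<in>{a}. x) \<in> ms_hom (ms_point a \<nu>) X"
  using assms by (auto simp: ms_hom_def)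

lemma ms_hom_carrier: "f \<in> ms_hom X Y \<Longrightarrow> x \<in> carrier X \<Longrightarrow> f x \<in> carrier Y"
  by (auto simp: ms_hom_def continuous_map_def)

lemma ms_hom_mult: "f \<in> ms_hom X Y \<Longrightarrow> x \<in> carrier X \<Longrightarrow> mult Y (f x) \<le> mult X x"
  by (simp add: ms_hom_def)

text \<open>Two points with the same image would give two factorisations of one arrow from a
  one-point multiset, against uniqueness.\<close>

lemma ms_equaliser_inj:
  fixes U :: "'u itself"
  assumes "ms_equaliser U E X Y e u v"
  shows "inj_on e (carrier E)"
proof (rule inj_onI)
  fix x y assume x: "x \<in> carrier E" and y: "y \<in> carrier E" and eq: "e x = e y"
  \<comment> \<open>Test objects must have points in \<open>'u\<close>; any element will do.\<close>
  define a where "a = (undefined :: 'u)"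
  \<comment> \<open>The join is large enough for both \<open>x\<close> and \<open>y\<close> to be
    images of the test point.\<close>
  define \<nu> where "\<nu> = sup (mult E x) (mult E y)"
  let ?Z = "ms_point a \<nu>"
  have e: "e \<in> ms_hom E X" "ms_comp E u e = ms_comp E v e"
    using assms by (auto simp: ms_equaliser_def)
  have "(\<lambda>z\<in>{a}. e x) \<in> ms_hom ?Z X"
    using ms_hom_mult[OF e(1) x] ms_hom_carrier[OF e(1) x]
    by (intro ms_point_hom) (auto simp: \<nu>_def intro: le_supI1)
  moreover have "ms_comp ?Z u (\<lambda>z\<in>{a}. e x) = ms_comp ?Z v (\<lambda>z\<in>{a}. e x)"
    using fun_cong[OF e(2), of x] x by (auto simp: compose_def fun_eq_iff)
  ultimately have "\<exists>!k. k \<in> ms_hom ?Z E \<and> ms_comp ?Z e k = (\<lambda>z\<in>{a}. e x)"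
    using assms ms_point_in_MS[of a \<nu>] unfolding ms_equaliser_def by blast
  moreover have "(\<lambda>z\<in>{a}. x) \<in> ms_hom ?Z E" "(\<lambda>z\<in>{a}. y) \<in> ms_hom ?Z E"
    using x y by (auto simp: \<nu>_def intro!: ms_point_hom)
  moreover have "ms_comp ?Z e (\<lambda>z\<in>{a}. x) = (\<lambda>z\<in>{a}. e x)"
    "ms_comp ?Z e (\<lambda>z\<in>{a}. y) = (\<lambda>z\<in>{a}. e x)"
    using eq by (auto simp: compose_def fun_eq_iff)
  ultimately have "(\<lambda>z\<in>{a}. x) = (\<lambda>z\<in>{a}. y)"
    by blast
  then show "x = y"
    by (metis restrict_apply' singletonI)
qed

text \<open>A test point with the multiplicity of \<open>e x\<close> maps to \<open>e x\<close>. Its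
  factorisation through \<open>E\<close> must hit \<open>x\<close> by injectivity, and arrows never
  raise multiplicities.\<close>

lemma ms_equaliser_mult:
  fixes U :: "'u itself"
  assumes "ms_equaliser U E X Y e u v" "x \<in> carrier E"
  shows "mult X (e x) = mult E x"
proof (rule antisym)
  have e: "e \<in> ms_hom E X" "ms_comp E u e = ms_comp E v e"
    using assms by (auto simp: ms_equaliser_def)
  show "mult X (e x) \<le> mult E x"
    using e(1) assms(2) by (rule ms_hom_mult)
  define a where "a = (undefined :: 'u)"
  let ?Z = "ms_point a (mult X (e x))"
  have "(\<lambda>z\<in>{a}. e x) \<in> ms_hom ?Z X"
    using ms_hom_carrier[OF e(1) assms(2)] by (intro ms_point_hom) auto
  moreover have "ms_comp ?Z u (\<lambda>z\<in>{a}. e x) = ms_comp ?Z v (\<lambda>z\<in>{a}. e x)"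
    using fun_cong[OF e(2), of x] assms(2) by (auto simp: compose_def fun_eq_iff)
  ultimately obtain k where k: "k \<in> ms_hom ?Z E" "ms_comp ?Z e k = (\<lambda>z\<in>{a}. e x)"
    using assms ms_point_in_MS[of a "mult X (e x)"] unfolding ms_equaliser_def by blast
  have "e (k a) = e x"
    using fun_cong[OF k(2), of a] by (simp add: compose_def)
  then have "k a = x"
    using ms_equaliser_inj[OF assms(1)] assms(2) ms_hom_carrier[OF k(1), of a]
    by (simp add: inj_on_eq_iff)
  then show "mult E x \<le> mult X (e x)"
    using ms_hom_mult[OF k(1), of a] by simp
qed

text \<open>The canonical arrow keeps multiplicities, and those of a product are suprema over the
  coordinates.\<close>

lemma mult_eq_Sup:
  fixes \<G> :: "'g mset_obj set"
  assumes "regularly_cogenerating TYPE('x) TYPE('u) \<G>"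
    and "X \<in> (MS :: 'x mset_obj set)" "x \<in> carrier X"
  shows "\<exists>V \<subseteq> (\<Union>G\<in>\<G>. mult G ` carrier G). mult X x = Sup V"
proof -
  let ?I = "hom_index \<G> X"
  let ?P = "ms_prod ?I (\<lambda>(G, t). G)"
  let ?e = "canonical_arrow \<G> X"
  obtain Y :: "'u mset_obj" and u v where eq: "ms_equaliser TYPE('u) X ?P Y ?e u v"
    using assms by (auto simp: regularly_cogenerating_def ms_regular_monic_def)
  have F: "(\<lambda>(G, t). G) = (fst :: 'g mset_obj \<times> ('x \<Rightarrow> 'g) \<Rightarrow> 'g mset_obj)"
    by auto
  have "?e \<in> ms_hom X ?P"
    using eq by (simp add: ms_equaliser_def)
  then have "?e x \<in> carrier ?P"
    using assms(3) by (rule ms_hom_carrier)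
  then have *: "?e x \<in> (\<Pi>\<^sub>E i\<in>?I. carrier (fst i))"
    unfolding F by simp
  have "mult X x = mult ?P (?e x)"
    using ms_equaliser_mult[OF eq assms(3)] by (rule sym)
  also have "\<dots> = (SUP i\<in>?I. mult (fst i) (?e x i))"
    unfolding F by (rule mult_ms_prod[OF *])
  finally have "mult X x = (SUP i\<in>?I. mult (fst i) (?e x i))" .
  \<comment> \<open>An index is a pair of some \<open>G\<close> in \<open>\<G>\<close> and an arrow
    into it, so the coordinate is a point of \<open>G\<close>.\<close>
  moreover have "mult (fst i) (?e x i) \<in> (\<Union>G\<in>\<G>. mult G ` carrier G)" if "i \<in> ?I" for i
    using that PiE_mem[OF * that] by (force simp: hom_index_def)
  ultimately show ?thesis
    by (intro exI[of _ "(\<lambda>i. mult (fst i) (?e x i)) ` ?I"]) auto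
qed

lemma infinite_UNIV_supernat: "infinite (UNIV :: supernat set)"
proof
  assume "finite (UNIV :: supernat set)"
  \<comment> \<open>Constant functions with finite values already suffice.\<close>
  moreover have "inj (\<lambda>n. (\<lambda>_. enat n) :: supernat)"
    by (auto simp: inj_def fun_eq_iff)
  ultimately show False
    by (metis finite_imageD finite_subset infinite_UNIV_nat subset_UNIV)
qed

theorem corollary3p13:
  fixes \<G> :: "'g mset_obj set"
  assumes "\<G> \<subseteq> MS"
    and "regularly_cogenerating TYPE('x) TYPE('u) \<G>"
  shows "infinite \<G> \<or> (\<exists>G\<in>\<G>. infinite (carrier G))"
proof (rule ccontr)
  assume *: "\<not> ?thesis"
  let ?V = "\<Union>G\<in>\<G>. mult G ` carrier G"
  \<comment> \<open>Every \<open>\<nu>\<close> is the multiplicity of the point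
    \<open>undefined\<close> of type \<open>'x\<close>.\<close>
  have "\<nu> \<in> Sup ` Pow ?V" for \<nu>
    using mult_eq_Sup[OF assms(2) ms_point_in_MS[of undefined \<nu>], of undefined] by auto
  then have "(UNIV :: supernat set) \<subseteq> Sup ` Pow ?V"
    by blast
  \<comment> \<open>\<open>?V\<close> is a finite union of finite sets, so it has finitely many
    subsets.\<close>
  moreover have "finite (Sup ` Pow ?V)"
    using * by simp
  ultimately show False
    using infinite_UNIV_supernat finite_subset by blast
qed

end
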